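(* Let $V$ be a finite set, let $\mathcal{G}=(V,E)$ be an undirected graph, and let $\mathcal{L}\subseteq\mathcal{T}(V)$ be a relation which is undirected pairwise Markov with respect to $\mathcal{G}$. Then $\mathcal{L}$ is undirected global Markov with respect to $\mathcal{G}$ if and only if $\mathcal{L}\cap[\mathcal{G}]$ is localizable and closed under the pseudographoid rule.
   Context: For a finite set $V$, $\mathcal{T}(V)$ is the set of all triples $(A,B|C)$ with $A,B,C\subseteq V$ pairwise disjoint and $A,B$ nonempty ($C$ may be empty). A relation is an arbitrary subset of $\mathcal{T}(V)$. Juxtaposition denotes union ($BC=B\cup C$), lowercase letters denote elements of $V$ identified with singletons, and $ab=\{a,b\}$. A relation $\mathcal{L}$ is localizable if for all pairwise disjoint $A,B,S\subseteq V$ with $A,B$ nonempty: $(A,B|S)\in\mathcal{L}$ if and only if $(a,b|S')\in\mathcal{L}$ for all $a\in A$, $b\in B$ and all $S'$ with $S\subseteq S'\subseteq SAB\setminus ab$. A relation $\mathcal{L}$ is closed under the pseudographoid rule if for all distinct $a,b,c\in V$ and $S\subseteq V\setminus\{a,b,c\}$: $(a,b|Sc),(a,c|Sb)\in\mathcal{L}$ implies $(a,b|S),(a,c|S)\in\mathcal{L}$. An undirected graph $\mathcal{G}=(V,E)$ has $E\subseteq V\times V$ with $(u,v)\in E\iff(v,u)\in E$; a path is a sequence of distinct vertices in which consecutive vertices are adjacent. For pairwise disjoint $A,B,S\subseteq V$, write $A\perp_{\mathcal{G}}B|S$ if for all $a\in A,b\in B$ every path from $a$ to $b$ in $\mathcal{G}$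 contains an element of $S$. Put $[\mathcal{G}]=\{(A,B|S)\in\mathcal{T}(V): A\perp_{\mathcal{G}}B|S\}$. $\mathcal{L}$ is undirected pairwise Markov with respect to $\mathcal{G}$ if for all distinct $a,b\in V$, $(a,b)\notin E$ implies $(a,b|V\setminus ab)\in\mathcal{L}$. $\mathcal{L}$ is undirected global Markov with respect to $\mathcal{G}$ if $A\perp_{\mathcal{G}}B|S$ implies $(A,B|S)\in\mathcal{L}$ for all $(A,B|S)\in\mathcal{T}(V)$, i.e. $[\mathcal{G}]\subseteq\mathcal{L}$.
   Formalization: The triples (A,B|C) and (B,A|C) are identified, so relations are symmetric in the first two components; for ordered triples and arbitrary non-symmetric relations the "if" direction fails, e.g. on three vertices with a single edge. *)

theory Defs
  imports Main "HOL-Library.Uprod"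
begin

text \<open>
  A triple (A,B|C) is read as a conditional independence statement, so (A,B|C) and (B,A|C) are
  the same triple: the pair of its first two components is unordered. The identification matters:
  for ordered triples and relations that need not be symmetric, the pseudographoid rule
  (which only mentions triples with a common first component) would not suffice to derive
  the global Markov property from the pairwise one.
\<close>

type_synonym 'a triple = "'a set uprod \<times> 'a set"

abbreviation triple :: "'a set \<Rightarrow> 'a set \<Rightarrow> 'a set \<Rightarrow> 'a triple" where
  "triple A B C \<equiv> (Upair A B, C)"

definition is_triple :: "'a set \<Rightarrow> 'a set \<Rightarrow> 'a set \<Rightarrow> 'a set \<Rightarrow> bool" where
  "is_triple V A B C \<longleftrightarrow>
     A \<subseteq> V \<and> B \<subseteq> V \<and> C \<subseteq> V \<and>
     A \<inter> B = {} \<and> A \<inter> C = {} \<and> B \<inter> C = {} \<and> A \<noteq> {} \<and> B \<noteq> {}"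

definition triples :: "'a set \<Rightarrow> 'a triple set" where
  "triples V = {triple A B C | A B C. is_triple V A B C}"

definition localizable :: "'a set \<Rightarrow> 'a triple set \<Rightarrow> bool" where
  "localizable V L \<longleftrightarrow>
     (\<forall>A B S. is_triple V A B S \<longrightarrow>
        (triple A B S \<in> L \<longleftrightarrow>
           (\<forall>a\<in>A. \<forall>b\<in>B. \<forall>S'. S \<subseteq> S' \<and> S' \<subseteq> (S \<union> A \<union> B) - {a, b} \<longrightarrow>
              triple {a} {b} S' \<in> L)))"

definition pseudographoid_closed :: "'a set \<Rightarrow> 'a triple set \<Rightarrow> bool" where
  "pseudographoid_closed V L \<longleftrightarrow>
     (\<forall>a\<in>V. \<forall>b\<in>V. \<forall>c\<in>V. \<forall>S. distinct [a, b, c] \<and> S \<subseteq> V - {a, b, c} \<longrightarrow>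
        triple {a} {b} (insert c S) \<in> L \<and> triple {a} {c} (insert b S) \<in> L \<longrightarrow>
        triple {a} {b} S \<in> L \<and> triple {a} {c} S \<in> L)"

text \<open>Loops are not excluded; they are irrelevant for paths, whose vertices are distinct.\<close>

definition undirected_graph :: "'a set \<Rightarrow> ('a \<times> 'a) set \<Rightarrow> bool" where
  "undirected_graph V E \<longleftrightarrow> E \<subseteq> V \<times> V \<and> sym E"

definition path_from_to :: "'a set \<Rightarrow> ('a \<times> 'a) set \<Rightarrow> 'a \<Rightarrow> 'a \<Rightarrow> 'a list \<Rightarrow> bool" where
  "path_from_to V E a b p \<longleftrightarrow>
     p \<noteq> [] \<and> hd p = a \<and> last p = b \<and> set p \<subseteq> V \<and> distinct p \<and>
     successively (\<lambda>u v. (u, v) \<in> E) p"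

definition separated :: "'a set \<Rightarrow> ('a \<times> 'a) set \<Rightarrow> 'a set \<Rightarrow> 'a set \<Rightarrow> 'a set \<Rightarrow> bool" where
  "separated V E A B S \<longleftrightarrow>
     (\<forall>a\<in>A. \<forall>b\<in>B. \<forall>p. path_from_to V E a b p \<longrightarrow> set p \<inter> S \<noteq> {})"

definition graph_relation :: "'a set \<Rightarrow> ('a \<times> 'a) set \<Rightarrow> 'a triple set" where
  "graph_relation V E = {triple A B S | A B S. is_triple V A B S \<and> separated V E A B S}"

definition pairwise_Markov :: "'a set \<Rightarrow> ('a \<times> 'a) set \<Rightarrow> 'a triple set \<Rightarrow> bool" where
  "pairwise_Markov V E L \<longleftrightarrow>
     (\<forall>a\<in>V. \<forall>b\<in>V. a \<noteq> b \<and> (a, b) \<notin> E \<longrightarrow> triple {a} {b} (V - {a, b}) \<in> L)"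

definition global_Markov :: "'a set \<Rightarrow> ('a \<times> 'a) set \<Rightarrow> 'a triple set \<Rightarrow> bool" where
  "global_Markov V E L \<longleftrightarrow>
     (\<forall>A B S. is_triple V A B S \<and> separated V E A B S \<longrightarrow> triple A B S \<in> L)"

end

theory Submission
  imports Defs
begin

text \<open>
  The key to both directions is that separation of \<open>A\<close> and \<open>B\<close> by \<open>S\<close> says that no
  vertex of \<open>A\<close> lies in the same connected component of \<open>V - S\<close> as a vertex of \<open>B\<close>.

  If \<open>L\<close> is global Markov, then \<open>L\<close> contains the whole separation relation of the graph, so the
  claim is that separation itself is localizable and closed under the pseudographoid rule.
  Localizability holds because enlarging a separator keeps it one, while the case \<open>S' = S\<close> of
  the local statements already gives separation of the sets. For the pseudographoid rule, a path
  from \<open>a\<close> to \<open>b\<close> that avoids \<open>S\<close> either avoids \<open>c\<close> as well or can be cut at \<open>c\<close>, which leaves a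
  path from \<open>a\<close> to \<open>c\<close> that avoids \<open>b\<close>.

  For the converse, localizability reduces the global Markov property to the singleton statements
  \<open>(a,b|S)\<close>, which are proved by downward induction on \<open>S\<close>. If \<open>S\<close> is everything but \<open>a\<close> and
  \<open>b\<close>, this is the pairwise Markov property. Otherwise take \<open>c\<close> outside of \<open>S \<union> {a, b}\<close>. Since
  \<open>S\<close> separates \<open>a\<close> from \<open>b\<close>, the vertex \<open>c\<close> cannot be connected to both of them outside of
  \<open>S\<close>. If \<open>S\<close> separates \<open>c\<close> from \<open>a\<close>, say, then the larger separators give \<open>(a,b|Sc)\<close> and
  \<open>(a,c|Sb)\<close>, and the pseudographoid rule removes \<open>c\<close> from the first of them. The case of \<open>b\<close> is
  the same, because the first two components of a triple are unordered.
\<close>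

abbreviation edges_off :: "'a set \<Rightarrow> ('a \<times> 'a) set \<Rightarrow> 'a set \<Rightarrow> ('a \<times> 'a) set" where
  "edges_off V E S \<equiv> E \<inter> (V - S) \<times> (V - S)"

text \<open>
  As the vertices of a path are distinct, cutting it at \<open>c\<close> loses its endpoint \<open>b\<close>
  unless \<open>b\<close> is \<open>c\<close>.
\<close>

lemma path_prefix:
  assumes "path_from_to V E a b p" and "c \<in> set p"
  obtains q where "path_from_to V E a c q" "set q \<subseteq> set p" "b \<in> set q \<longrightarrow> b = c"
proof -
  obtain xs ys where p: "p = xs @ c # ys"
    using assms(2) by (meson split_list)
  have path: "path_from_to V E a c (xs @ [c])"
    using assms(1) unfolding p path_from_to_def
    by (auto simp: hd_append successively_append_iff)
  have "b = c" if "b \<in> set (xs @ [c])"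
    using assms(1) that unfolding p path_from_to_def by (auto split: if_splits)
  with path show thesis
    by (intro that[of "xs @ [c]"]) (auto simp: p)
qed

lemma successively_rtrancl:
  assumes "successively (\<lambda>u v. (u, v) \<in> R) p" and "p \<noteq> []"
  shows "(hd p, last p) \<in> R\<^sup>*"
  using assms
proof (induction p rule: induct_list012)
  case (3 x y zs)
  then show ?case by (auto intro: converse_rtrancl_into_rtrancl)
qed auto

lemma rtrancl_of_path:
  assumes "path_from_to V E a b p" and "set p \<inter> S = {}"
  shows "(a, b) \<in> (edges_off V E S)\<^sup>*"
proof -
  have "successively (\<lambda>u v. (u, v) \<in> edges_off V E S) p"
  proof (rule successively_mono)
    show "successively (\<lambda>u v. (u, v) \<in> E) p"
      using assms(1) by (simp add: path_from_to_def)
  qed (use assms in \<open>auto simp: path_from_to_def\<close>)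
  from successively_rtrancl[OF this] show ?thesis
    using assms by (auto simp: path_from_to_def)
qed

text \<open>
  A walk becomes a path by adding its vertices one at a time and going back to the earlier
  visit whenever a vertex is repeated.
\<close>

lemma path_of_rtrancl:
  assumes "(a, b) \<in> (edges_off V E S)\<^sup>*" and "a \<in> V - S"
  shows "\<exists>p. path_from_to V E a b p \<and> set p \<inter> S = {}"
  using assms(1)
proof (induction rule: rtrancl_induct)
  case base
  have "path_from_to V E a a [a]"
    using assms(2) by (auto simp: path_from_to_def)
  then show ?case using assms(2) by (intro exI[of _ "[a]"]) auto
next
  case (step y z)
  from step.IH obtain p where p: "path_from_to V E a y p" "set p \<inter> S = {}" by blast
  show ?case
  proof (cases "z \<in> set p")
    case True
    obtain q where "path_from_to V E a z q" "set q \<subseteq> set p"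
      by (rule path_prefix[OF p(1) True])
    with p(2) show ?thesis by (intro exI[of _ q]) auto
  next
    case False
    then have "path_from_to V E a z (p @ [z])"
      using p step.hyps by (auto simp: path_from_to_def successively_append_iff)
    then show ?thesis using p(2) step.hyps by (intro exI[of _ "p @ [z]"]) auto
  qed
qed

lemma separated_iff_rtrancl:
  assumes "A \<subseteq> V - S"
  shows "separated V E A B S \<longleftrightarrow> (\<forall>a\<in>A. \<forall>b\<in>B. (a, b) \<notin> (edges_off V E S)\<^sup>*)"
proof -
  have "(\<forall>p. path_from_to V E a b p \<longrightarrow> set p \<inter> S \<noteq> {}) \<longleftrightarrow> (a, b) \<notin> (edges_off V E S)\<^sup>*"
    if "a \<in> A" for a b
  proof -
    have "a \<in> V - S" using assms that by (rule subsetD)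
    then show ?thesis using path_of_rtrancl[of a b E V S] rtrancl_of_path[of V E a b _ S] by blast
  qed
  then show ?thesis unfolding separated_def by simp
qed

lemma rtrancl_edges_off_sym:
  assumes "sym E" and "(a, b) \<in> (edges_off V E S)\<^sup>*"
  shows "(b, a) \<in> (edges_off V E S)\<^sup>*"
proof -
  have "sym (edges_off V E S)" using assms(1) by (auto simp: sym_def)
  then show ?thesis using assms(2) by (meson sym_rtrancl symD)
qed

lemma separated_sym:
  assumes "sym E" and "is_triple V A B S"
  shows "separated V E A B S \<longleftrightarrow> separated V E B A S"
proof -
  have "A \<subseteq> V - S" "B \<subseteq> V - S" using assms(2) by (auto simp: is_triple_def)
  then show ?thesis
    unfolding separated_iff_rtrancl[OF \<open>A \<subseteq> V - S\<close>] separated_iff_rtrancl[OF \<open>B \<subseteq> V - S\<close>]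
    using rtrancl_edges_off_sym[OF assms(1)] by blast
qed

lemma is_triple_commute: "is_triple V A B S \<longleftrightarrow> is_triple V B A S"
  by (auto simp: is_triple_def)

lemma is_triple_singletons:
  "is_triple V {a} {b} S \<longleftrightarrow> a \<in> V \<and> b \<in> V \<and> a \<noteq> b \<and> S \<subseteq> V - {a, b}"
  by (auto simp: is_triple_def)

text \<open>
  Membership of an unordered triple can be read off either of its two orderings only because
  separation in an undirected graph is symmetric.
\<close>

lemma triple_in_graph_relation:
  assumes "sym E"
  shows "triple A B S \<in> graph_relation V E \<longleftrightarrow> is_triple V A B S \<and> separated V E A B S"
proof
  assume "triple A B S \<in> graph_relation V E"
  then have "is_triple V A B S \<and> separated V E A B S \<or> is_triple V B A S \<and> separated V E B A S"
    by (auto simp: graph_relation_def)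
  then show "is_triple V A B S \<and> separated V E A B S"
    using separated_sym[OF assms] is_triple_commute by metis
qed (auto simp: graph_relation_def)

lemma separated_mono:
  assumes "separated V E A B S" and "A' \<subseteq> A" "B' \<subseteq> B" "S \<subseteq> S'"
  shows "separated V E A' B' S'"
  using assms unfolding separated_def by blast

lemma localizable_graph_relation:
  assumes "sym E"
  shows "localizable V (graph_relation V E)"
  unfolding localizable_def
proof (intro allI impI iffI ballI)
  fix A B S a b S'
  assume "is_triple V A B S" "triple A B S \<in> graph_relation V E" "a \<in> A" "b \<in> B"
    and S': "S \<subseteq> S' \<and> S' \<subseteq> S \<union> A \<union> B - {a, b}"
  moreover from this have "is_triple V {a} {b} S'"
    unfolding is_triple_singletons by (auto simp: is_triple_def)
  ultimately show "triple {a} {b} S' \<in> graph_relation V E"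
    by (auto simp: triple_in_graph_relation[OF assms] elim: separated_mono)
next
  fix A B S
  assume tr: "is_triple V A B S"
    and loc: "\<forall>a\<in>A. \<forall>b\<in>B. \<forall>S'. S \<subseteq> S' \<and> S' \<subseteq> S \<union> A \<union> B - {a, b} \<longrightarrow>
      triple {a} {b} S' \<in> graph_relation V E"
  have "separated V E {a} {b} S" if "a \<in> A" "b \<in> B" for a b
  proof -
    have "S \<subseteq> S \<union> A \<union> B - {a, b}" using tr that by (auto simp: is_triple_def)
    then have "triple {a} {b} S \<in> graph_relation V E" using loc that by blast
    then show ?thesis by (simp add: triple_in_graph_relation[OF assms])
  qed
  then have "separated V E A B S" by (simp add: separated_def)
  with tr show "triple A B S \<in> graph_relation V E"
    by (simp add: triple_in_graph_relation[OF assms])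
qed

lemma separated_pseudographoid:
  assumes "separated V E {a} {b} (insert c S)" and "separated V E {a} {c} (insert b S)"
    and "b \<noteq> c"
  shows "separated V E {a} {b} S"
  unfolding separated_def
proof (intro ballI allI impI)
  fix a' b' p
  assume "a' \<in> {a}" "b' \<in> {b}" "path_from_to V E a' b' p"
  then have p: "path_from_to V E a b p" by simp
  show "set p \<inter> S \<noteq> {}"
  proof (cases "c \<in> set p")
    case True
    obtain q where "path_from_to V E a c q" "set q \<subseteq> set p" "b \<in> set q \<longrightarrow> b = c"
      by (rule path_prefix[OF p True])
    moreover from this assms(3) have "b \<notin> set q" by blast
    ultimately show ?thesis using assms(2) by (auto simp: separated_def)
  next
    case False
    then show ?thesis using assms(1) p by (auto simp: separated_def)
  qed
qed

lemma pseudographoid_closed_graph_relation: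
  assumes "sym E"
  shows "pseudographoid_closed V (graph_relation V E)"
  unfolding pseudographoid_closed_def triple_in_graph_relation[OF assms] is_triple_singletons
  by (auto intro: separated_pseudographoid)

text \<open>
  A vertex connected to both \<open>a\<close> and \<open>b\<close> outside of \<open>S\<close> would connect them to each other.
\<close>

lemma separated_third_vertex:
  assumes "sym E" and "separated V E {a} {b} S"
    and "a \<in> V - S" "b \<in> V - S"
  shows "separated V E {a} {c} S \<or> separated V E {b} {c} S"
proof -
  have "(a, b) \<notin> (edges_off V E S)\<^sup>*"
    using assms separated_iff_rtrancl[of "{a}" V S E "{b}"] by auto
  then have "(a, c) \<notin> (edges_off V E S)\<^sup>* \<or> (b, c) \<notin> (edges_off V E S)\<^sup>*"
    using rtrancl_edges_off_sym[OF assms(1)] by (meson rtrancl_trans)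
  then show ?thesis
    using assms separated_iff_rtrancl[of "{a}" V S E "{c}"]
      separated_iff_rtrancl[of "{b}" V S E "{c}"] by auto
qed

lemma separated_imp_nonadjacent:
  assumes "separated V E {a} {b} S" and "a \<in> V - S" "b \<in> V - S" "a \<noteq> b"
  shows "(a, b) \<notin> E"
proof
  assume "(a, b) \<in> E"
  with assms have "path_from_to V E a b [a, b]" by (auto simp: path_from_to_def)
  with assms(1) have "set [a, b] \<inter> S \<noteq> {}" by (auto simp: separated_def)
  with assms show False by auto
qed

text \<open>
  The downward induction over separators. The induction hypothesis covers all pairs of vertices
  at once, as the step also calls upon the pair \<open>a, c\<close> or \<open>b, c\<close>.
\<close>

lemma pairwise_imp_local_Markov:
  assumes "finite V" and "sym E" and "pairwise_Markov V E L"
    and closed: "pseudographoid_closed V (L \<inter> graph_relation V E)"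
    and "is_triple V {a} {b} S" and "separated V E {a} {b} S"
  shows "triple {a} {b} S \<in> L \<inter> graph_relation V E"
  using assms(5,6)
proof (induction "card (V - S)" arbitrary: a b S rule: less_induct)
  case less
  let ?M = "L \<inter> graph_relation V E"
  note ab = less.prems(1)[unfolded is_triple_singletons]
  have smaller: "triple {x} {y} (insert z S) \<in> ?M"
    if "separated V E {x} {y} S" "is_triple V {x} {y} S" "z \<in> V - S" "z \<noteq> x" "z \<noteq> y" for x y z
  proof (rule less.hyps)
    show "card (V - insert z S) < card (V - S)"
      using that assms(1) by (intro psubset_card_mono) auto
    show "is_triple V {x} {y} (insert z S)"
      using that by (auto simp: is_triple_singletons)
    show "separated V E {x} {y} (insert z S)"
      using that(1) by (rule separated_mono) auto
  qed
  show ?case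
  proof (cases "S = V - {a, b}")
    case True
    have "(a, b) \<notin> E"
      using separated_imp_nonadjacent[OF less.prems(2)] ab by auto
    then have "triple {a} {b} S \<in> L"
      using assms(3) ab True by (auto simp: pairwise_Markov_def)
    then show ?thesis
      using less.prems by (simp add: triple_in_graph_relation[OF assms(2)])
  next
    case False
    then obtain c where c: "c \<in> V - S" "c \<noteq> a" "c \<noteq> b" using ab by blast
    have drop: "triple {x} {y} S \<in> ?M"
      if "{x, y} = {a, b}" "separated V E {x} {y} S" "separated V E {x} {c} S" for x y
    proof -
      have xy: "x \<in> V - S" "y \<in> V - S" "x \<noteq> y" "c \<noteq> x" "c \<noteq> y"
        using that(1) ab c by (auto simp: doubleton_eq_iff)
      have "triple {x} {y} (insert c S) \<in> ?M" "triple {x} {c} (insert y S) \<in> ?M"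
        using smaller[of x y c] smaller[of x c y] that xy c ab
        by (auto simp: is_triple_singletons)
      moreover have "S \<subseteq> V - {x, y, c}" using xy c ab by blast
      ultimately show ?thesis
        using closed[unfolded pseudographoid_closed_def, rule_format, of x y c S] xy c by auto
    qed
    have ba: "separated V E {b} {a} S"
      using less.prems separated_sym[OF assms(2)] by blast
    have "separated V E {a} {c} S \<or> separated V E {b} {c} S"
      using separated_third_vertex[OF assms(2) less.prems(2)] ab by auto
    then have "triple {a} {b} S \<in> ?M \<or> triple {b} {a} S \<in> ?M"
      using drop[of a b] drop[of b a] less.prems(2) ba by blast
    then show ?thesis by (metis Upair_inject)
  qed
qed

theorem theorem4p3:
  fixes V :: "'a set" and E :: "('a \<times> 'a) set" and L :: "'a triple set"
  assumes "finite V"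
    and "undirected_graph V E"
    and "L \<subseteq> triples V"
    and "pairwise_Markov V E L"
  shows "global_Markov V E L \<longleftrightarrow>
    localizable V (L \<inter> graph_relation V E) \<and>
    pseudographoid_closed V (L \<inter> graph_relation V E)"
proof (intro iffI conjI)
  have sym: "sym E" using assms(2) by (simp add: undirected_graph_def)
  {
    assume "global_Markov V E L"
    then have "L \<inter> graph_relation V E = graph_relation V E"
      by (auto simp: global_Markov_def graph_relation_def)
    then show "localizable V (L \<inter> graph_relation V E)"
      and "pseudographoid_closed V (L \<inter> graph_relation V E)"
      using localizable_graph_relation[OF sym] pseudographoid_closed_graph_relation[OF sym]
      by simp_all
  }
  assume loc: "localizable V (L \<inter> graph_relation V E) \<and>
    pseudographoid_closed V (L \<inter> graph_relation V E)"
  show "global_Markov V E L"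
    unfolding global_Markov_def
  proof (intro allI impI)
    fix A B S
    assume AB: "is_triple V A B S \<and> separated V E A B S"
    have "triple {a} {b} S' \<in> L \<inter> graph_relation V E"
      if "a \<in> A" "b \<in> B" "S \<subseteq> S' \<and> S' \<subseteq> S \<union> A \<union> B - {a, b}" for a b S'
    proof (rule pairwise_imp_local_Markov[OF assms(1) sym assms(4)])
      show "pseudographoid_closed V (L \<inter> graph_relation V E)" using loc by simp
      show "is_triple V {a} {b} S'"
        using AB that unfolding is_triple_singletons by (auto simp: is_triple_def)
      show "separated V E {a} {b} S'"
        using AB that by (auto elim: separated_mono)
    qed
    then have "triple A B S \<in> L \<inter> graph_relation V E"
      using loc AB unfolding localizable_def by blast
    then show "triple A B S \<in> L" by simp
  qed
qed

end
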